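(* Let $d\geq 2$ be an integer, let $(F_n^{(d)})_{n\in\mathbb{Z}}$ be the $d$-generalized Fibonacci numbers, let $q=q_d$ be the unique number in $(0,1)$ with $q+q^2+\dots+q^d=1$, and let \[c_d=\frac{1}{\sum_{i=1}^d i q^i}=\frac{(q-1)^2}{dq^{d+2}-(d+1)q^{d+1}+q}.\] Then $F_n^{(d)}$ is asymptotically equivalent to $c_d q^{-(n-1)}$ as $n\to\infty$, i.e. \[\lim_{n\to\infty}\frac{F_n^{(d)}}{c_d\,q^{-(n-1)}}=1.\]
   Context: For an integer $d\geq 2$, the $d$-generalized Fibonacci numbers $F_n^{(d)}$, $n\in\mathbb{Z}$, are defined by $F_n^{(d)}=0$ for all $n\leq 0$, $F_1^{(d)}=1$, and $F_n^{(d)}=\sum_{i=1}^d F_{n-i}^{(d)}$ for all $n\geq 2$. *)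

theory Defs
  imports Complex_Main "HOL-Library.Landau_Symbols"
begin

function gen_fib :: "nat \<Rightarrow> int \<Rightarrow> nat" where
  "gen_fib d n =
     (if n \<le> 0 then 0
      else if n = 1 then 1
      else (\<Sum>i=1..d. gen_fib d (n - int i)))"
  by pat_completeness auto
termination
  by (relation "measure (\<lambda>(d, n). nat n)") auto

declare gen_fib.simps [simp del]

definition gen_fib_root :: "nat \<Rightarrow> real" where
  "gen_fib_root d = (THE q. 0 < q \<and> q < 1 \<and> (\<Sum>i=1..d. q ^ i) = 1)"

definition gen_fib_const :: "nat \<Rightarrow> real" where
  "gen_fib_const d = 1 / (\<Sum>i=1..d. real i * gen_fib_root d ^ i)"

end

theory Submission
  imports Defs
begin

text \<open>
  Put \<open>u n = F n * q ^ (n - 1)\<close>. The Fibonacci recurrence becomes an averaging recurrence: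
  each value is a convex combination, with fixed positive weights \<open>q ^ i\<close>, of the previous \<open>d\<close> ones.
  Weighting a window of \<open>d\<close> consecutive values by the partial sums of the weights gives
  a conserved quantity, which identifies the only possible limit. After this limit is subtracted,
  the conserved quantity is \<open>0\<close>, so no window consists only of positive or only of negative values,
  and averaging therefore shrinks the sup norm of windows by a factor bounded away from \<open>1\<close>.
\<close>

section \<open>Convergence of averaging recurrences\<close>

text \<open>Shifting the window by one lowers the weight of each surviving value to the preceding
  partial sum, and the new value enters with full weight \<open>1\<close>. Expanding the new value
  by the recurrence gives back exactly the missing \<open>p i\<close>.\<close>

lemma averaging_invariant:
  fixes a p :: "nat \<Rightarrow> real"
  assumes d: "d > 0"
    and sum_p: "(\<Sum>i<d. p i) = 1"
    and rec: "\<And>n. a (n + d) = (\<Sum>i<d. p i * a (n + i))"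
  shows "(\<Sum>i<d. (\<Sum>j\<le>i. p j) * a (n + i)) = (\<Sum>i<d. (\<Sum>j\<le>i. p j) * a i)"
proof (induction n)
  case 0
  then show ?case by simp
next
  case (Suc n)
  obtain k where k: "d = Suc k" using d by (cases d) auto
  have "(\<Sum>i<d. (\<Sum>j\<le>i. p j) * a (Suc n + i))
      = (\<Sum>i<k. (\<Sum>j\<le>i. p j) * a (n + Suc i)) + a (n + d)"
    using sum_p unfolding k lessThan_Suc_atMost by (simp add: lessThan_Suc_atMost[symmetric])
  also have "a (n + d) = p 0 * a n + (\<Sum>i<k. p (Suc i) * a (n + Suc i))"
    unfolding rec unfolding k sum.lessThan_Suc_shift by simp
  also have "(\<Sum>i<k. (\<Sum>j\<le>i. p j) * a (n + Suc i)) + \<dots>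
      = (\<Sum>i<d. (\<Sum>j\<le>i. p j) * a (n + i))"
    unfolding k sum.lessThan_Suc_shift by (simp add: sum.distrib algebra_simps)
  finally show ?case using Suc.IH by simp
qed

text \<open>A sum with positive weights \<open>R\<close> can vanish only if some \<open>e j\<close>
  is nonpositive. That term contributes at most \<open>0\<close> to the average, and the other
  weights total \<open>1 - p j\<close>, which is at most \<open>1 - \<epsilon>\<close>.\<close>

lemma averaging_contracts_above:
  fixes e p R :: "nat \<Rightarrow> real"
  assumes d: "d > 0"
    and p: "\<And>i. i < d \<Longrightarrow> \<epsilon> \<le> p i" and \<epsilon>: "\<epsilon> > 0"
    and sum_p: "(\<Sum>i<d. p i) = 1"
    and R: "\<And>i. i < d \<Longrightarrow> R i > 0" and sum_R: "(\<Sum>i<d. R i * e i) = 0"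
    and B: "\<And>i. i < d \<Longrightarrow> e i \<le> B" "B \<ge> 0"
  shows "(\<Sum>i<d. p i * e i) \<le> (1 - \<epsilon>) * B"
proof -
  obtain j where j: "j < d" "e j \<le> 0"
  proof (rule ccontr)
    assume "\<not> thesis"
    then have "\<And>i. i < d \<Longrightarrow> e i > 0" using that by force
    then have "(\<Sum>i<d. R i * e i) > 0"
      using d R by (intro sum_pos) auto
    then show False using sum_R by simp
  qed
  have pp: "p i > 0" if "i < d" for i using p[OF that] \<epsilon> by simp
  have "(\<Sum>i<d. p i * e i) = p j * e j + (\<Sum>i\<in>{..<d}-{j}. p i * e i)"
    using j by (simp add: sum.remove)
  also have "\<dots> \<le> 0 + (\<Sum>i\<in>{..<d}-{j}. p i * B)"
    using j pp B by (intro add_mono sum_mono mult_left_mono) (auto simp: mult_le_0_iff less_imp_le)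
  also have "\<dots> = (1 - p j) * B"
    using j sum_p by (simp add: sum_distrib_right[symmetric] sum_diff1)
  also have "\<dots> \<le> (1 - \<epsilon>) * B"
    using p[OF j(1)] B by (intro mult_right_mono) auto
  finally show ?thesis .
qed

lemma averaging_contracts:
  fixes e p R :: "nat \<Rightarrow> real"
  assumes "d > 0"
    and "\<And>i. i < d \<Longrightarrow> \<epsilon> \<le> p i" and "\<epsilon> > 0"
    and "(\<Sum>i<d. p i) = 1"
    and "\<And>i. i < d \<Longrightarrow> R i > 0" and "(\<Sum>i<d. R i * e i) = 0"
    and B: "\<And>i. i < d \<Longrightarrow> \<bar>e i\<bar> \<le> B"
  shows "\<bar>\<Sum>i<d. p i * e i\<bar> \<le> (1 - \<epsilon>) * B"
proof -
  have "B \<ge> 0" using B[OF assms(1)] by linarith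
  moreover have "e i \<le> B" "- e i \<le> B" if "i < d" for i using B[OF that] by auto
  ultimately have "(\<Sum>i<d. p i * e i) \<le> (1 - \<epsilon>) * B" "(\<Sum>i<d. p i * - e i) \<le> (1 - \<epsilon>) * B"
    using assms averaging_contracts_above[of d \<epsilon> p R e B]
      averaging_contracts_above[of d \<epsilon> p R "\<lambda>i. - e i" B]
    by (simp_all add: sum_negf)
  then show ?thesis by (simp add: sum_negf)
qed

lemma averaging_tendsto_zero:
  fixes e p R :: "nat \<Rightarrow> real"
  assumes d: "d > 0"
    and p: "\<And>i. i < d \<Longrightarrow> p i > 0" and sum_p: "(\<Sum>i<d. p i) = 1"
    and rec: "\<And>n. e (n + d) = (\<Sum>i<d. p i * e (n + i))"
    and R: "\<And>i. i < d \<Longrightarrow> R i > 0" and inv: "\<And>n. (\<Sum>i<d. R i * e (n + i)) = 0"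
  shows "e \<longlonglongrightarrow> 0"
proof -
  define \<epsilon> where "\<epsilon> = Min (p ` {..<d})"
  define B where "B = Max ((\<lambda>i. \<bar>e i\<bar>) ` {..<d})"
  have \<epsilon>: "\<epsilon> > 0" "\<And>i. i < d \<Longrightarrow> \<epsilon> \<le> p i"
    unfolding \<epsilon>_def using d p by (subst Min_gr_iff, auto)
  have "p 0 \<le> (\<Sum>i<d. p i)" using d p by (intro member_le_sum) (auto intro: less_imp_le)
  then have \<epsilon>1: "\<epsilon> \<le> 1" using \<epsilon>(2)[OF d] sum_p by simp
  have B: "\<bar>e i\<bar> \<le> B" if "i < d" for i unfolding B_def using that by auto
  have B0: "B \<ge> 0" using B[OF d] by linarith
  have step: "\<bar>e (n + d)\<bar> \<le> (1 - \<epsilon>) * C" if "\<And>i. i < d \<Longrightarrow> \<bar>e (n + i)\<bar> \<le> C" for n C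
    unfolding rec using that \<epsilon> d sum_p R inv by (intro averaging_contracts[where R = R]) auto
  \<comment> \<open>Passing from a window to the value after it gains one factor
    \<open>1 - \<epsilon>\<close>, and adding \<open>d\<close> to the index raises the quotient by
    \<open>d\<close> by exactly one.\<close>
  have bound: "\<bar>e n\<bar> \<le> (1 - \<epsilon>) ^ (n div d) * B" for n
  proof (induction n rule: less_induct)
    case (less n)
    show ?case
    proof (cases "n < d")
      case True
      then show ?thesis using B by simp
    next
      case False
      define m where "m = n - d"
      have n: "n = m + d" using False by (simp add: m_def)
      \<comment> \<open>Every index of this window is below \<open>n\<close>, so the induction
        hypothesis applies. Since \<open>1 - \<epsilon>\<close> lies between \<open>0\<close> and
        \<open>1\<close>, the exponents can all be lowered to \<open>m div d\<close>, giving one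
        bound for the window.\<close>
      have "\<bar>e (m + i)\<bar> \<le> (1 - \<epsilon>) ^ (m div d) * B" if "i < d" for i
      proof -
        have "\<bar>e (m + i)\<bar> \<le> (1 - \<epsilon>) ^ ((m + i) div d) * B"
          using less[of "m + i"] that n by simp
        also have "\<dots> \<le> (1 - \<epsilon>) ^ (m div d) * B"
          using \<epsilon> \<epsilon>1 B0 by (intro mult_right_mono power_decreasing div_le_mono) auto
        finally show ?thesis .
      qed
      from step[OF this] show ?thesis using d by (simp add: n)
    qed
  qed
  have "(\<lambda>n. (1 - \<epsilon>) ^ (n div d) * B) \<longlonglongrightarrow> 0 * B"
  proof (intro tendsto_intros)
    have "filterlim (\<lambda>n. n div d) at_top sequentially"
      unfolding filterlim_at_top
    proof
      fix k
      show "\<forall>\<^sub>F n in sequentially. k \<le> n div d"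
        using eventually_ge_at_top[of "k * d"]
        by eventually_elim (use d in \<open>simp add: less_eq_div_iff_mult_less_eq\<close>)
    qed
    moreover have "(\<lambda>k. (1 - \<epsilon>) ^ k) \<longlonglongrightarrow> 0"
      using \<epsilon> \<epsilon>1 by (intro LIMSEQ_power_zero) auto
    ultimately show "(\<lambda>n. (1 - \<epsilon>) ^ (n div d)) \<longlonglongrightarrow> 0"
      by (rule filterlim_compose[rotated])
  qed
  then have "(\<lambda>n. (1 - \<epsilon>) ^ (n div d) * B) \<longlonglongrightarrow> 0" by simp
  then show ?thesis
    by (rule tendsto_rabs_zero_cancel[OF tendsto_sandwich[OF _ _ tendsto_const], rotated 2])
      (use bound in simp_all)
qed

text \<open>The constant sequence \<open>L\<close> satisfies the recurrence because the weights sum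
  to \<open>1\<close>, and \<open>L\<close> is chosen to have the same conserved quantity as
  \<open>a\<close>. The difference is therefore an averaging sequence with conserved quantity
  \<open>0\<close>.\<close>

lemma averaging_tendsto:
  fixes a p :: "nat \<Rightarrow> real"
  assumes d: "d > 0"
    and p: "\<And>i. i < d \<Longrightarrow> p i > 0" and sum_p: "(\<Sum>i<d. p i) = 1"
    and rec: "\<And>n. a (n + d) = (\<Sum>i<d. p i * a (n + i))"
  shows "a \<longlonglongrightarrow> (\<Sum>i<d. (\<Sum>j\<le>i. p j) * a i) / (\<Sum>i<d. \<Sum>j\<le>i. p j)"
proof -
  define R where "R i = (\<Sum>j\<le>i. p j)" for i
  define L where "L = (\<Sum>i<d. R i * a i) / (\<Sum>i<d. R i)"
  have R: "R i > 0" if "i < d" for i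
    unfolding R_def using that p by (intro sum_pos) auto
  have "(\<Sum>i<d. R i) > 0" using d R by (intro sum_pos) auto
  then have L: "(\<Sum>i<d. R i * a i) = (\<Sum>i<d. R i) * L" by (simp add: L_def)
  have "(\<lambda>n. a n - L) \<longlonglongrightarrow> 0"
  proof (rule averaging_tendsto_zero[OF d p sum_p _ R])
    show "a (n + d) - L = (\<Sum>i<d. p i * (a (n + i) - L))" for n
      using sum_p by (simp add: rec right_diff_distrib sum_subtractf sum_distrib_right[symmetric])
    show "(\<Sum>i<d. R i * (a (n + i) - L)) = 0" for n
      using averaging_invariant[OF d sum_p rec, of n] L
      by (simp add: R_def right_diff_distrib sum_subtractf sum_distrib_right[symmetric])
  qed auto
  then show ?thesis by (simp add: L_def R_def LIM_zero_iff)
qed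

section \<open>The root \<open>q\<close> and a closed form for the weighted power sum\<close>

text \<open>On the nonnegative reals the sum is strictly increasing, with value \<open>0\<close> at
  \<open>0\<close> and \<open>d > 1\<close> at \<open>1\<close>, so it takes the value
  \<open>1\<close> exactly once, strictly in between.\<close>

lemma ex1_sum_power_eq_1:
  assumes "d \<ge> 2"
  shows "\<exists>!x::real. 0 < x \<and> x < 1 \<and> (\<Sum>i=1..d. x ^ i) = 1"
proof -
  define f where "f x = (\<Sum>i=1..d. x ^ i)" for x :: real
  have mono: "f x < f y" if "0 \<le> x" "x < y" for x y
    unfolding f_def using that assms by (intro sum_strict_mono power_strict_mono) auto
  have f0: "f 0 = 0" by (simp add: f_def power_0_left)
  have f1: "f 1 = d" by (simp add: f_def)
  have "\<exists>x\<ge>0. x \<le> 1 \<and> f x = 1"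
    using assms f0 f1 by (intro IVT) (auto simp: f_def)
  then obtain x where "0 \<le> x" "x \<le> 1" "f x = 1" by blast
  moreover from this have "x \<noteq> 0" "x \<noteq> 1" using f0 f1 assms by auto
  ultimately have x: "0 < x \<and> x < 1 \<and> f x = 1" by auto
  moreover have "y = x" if "0 < y \<and> y < 1 \<and> f y = 1" for y
    using mono[of x y] mono[of y x] that x by (cases x y rule: linorder_cases) auto
  ultimately show ?thesis unfolding f_def by blast
qed

lemma gen_fib_root:
  assumes "d \<ge> 2"
  shows "0 < gen_fib_root d" "gen_fib_root d < 1" "(\<Sum>i=1..d. gen_fib_root d ^ i) = 1"
  using theI'[OF ex1_sum_power_eq_1[OF assms]] unfolding gen_fib_root_def by auto

text \<open>Stated without division, so that induction on \<open>n\<close> is pure ring algebra;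
  dividing later yields the closed form of \<open>gen_fib_const\<close>.\<close>

lemma sum_of_nat_mult_power:
  fixes x :: "'a :: comm_ring_1"
  shows "(x - 1)^2 * (\<Sum>i=1..n. of_nat i * x ^ i) =
    of_nat n * x ^ (n + 2) - of_nat (n + 1) * x ^ (n + 1) + x"
proof (induction n)
  case 0
  then show ?case by simp
next
  case (Suc n)
  then show ?case by (simp add: distrib_left power2_eq_square) (simp add: algebra_simps)
qed

section \<open>Asymptotics of the generalized Fibonacci numbers\<close>

lemma gen_fib_of_le_0 [simp]: "n \<le> 0 \<Longrightarrow> gen_fib d n = 0"
  by (simp add: gen_fib.simps)

lemma gen_fib_1 [simp]: "gen_fib d 1 = 1"
  by (simp add: gen_fib.simps)

lemma gen_fib_rec: "n \<ge> 2 \<Longrightarrow> gen_fib d n = (\<Sum>i=1..d. gen_fib d (n - int i))"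
  by (subst gen_fib.simps) simp

lemma sum_lessThan_reflect: "(\<Sum>i<d. f (d - i)) = (\<Sum>i=1..d. f i)" for d :: nat
  by (rule sum.reindex_bij_witness[of _ "\<lambda>i. d - i" "\<lambda>i. d - i"]) auto

text \<open>The index shift makes the first window the Fibonacci numbers with indices
  \<open>2 - d\<close> to \<open>1\<close>, that is zeros followed by a single \<open>1\<close>,
  while the recurrence holds from the next term on.\<close>

lemma gen_fib_scaled_tendsto:
  assumes d: "d \<ge> 2"
  defines "q \<equiv> gen_fib_root d"
  shows "(\<lambda>n. real (gen_fib d (int n + 2 - int d)) * q powi (int n + 1 - int d))
    \<longlonglongrightarrow> gen_fib_const d" (is "?a \<longlonglongrightarrow> _")
proof -
  have q: "0 < q" "(\<Sum>i=1..d. q ^ i) = 1" using gen_fib_root[OF d] by (auto simp: q_def)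
  \<comment> \<open>Position \<open>i\<close> of a window lies \<open>d - i\<close> places before
    the value being computed.\<close>
  define p where "p i = q ^ (d - i)" for i
  have sum_p: "(\<Sum>i<d. p i) = 1" using q sum_lessThan_reflect[of "\<lambda>i. q ^ i" d] by (simp add: p_def)
  have rec: "?a (n + d) = (\<Sum>i<d. p i * ?a (n + i))" for n
  proof -
    have "?a (n + d) = (\<Sum>i=1..d. real (gen_fib d (int n + 2 - int i))) * q powi (int n + 1)"
      by (simp add: gen_fib_rec)
    also have "\<dots> = (\<Sum>i<d. real (gen_fib d (int n + 2 - int (d - i))) * q powi (int n + 1))"
      unfolding sum_distrib_right by (rule sum_lessThan_reflect[symmetric])
    also have "\<dots> = (\<Sum>i<d. p i * ?a (n + i))"
    proof (rule sum.cong)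
      fix i assume "i \<in> {..<d}"
      then have i: "i < d" by simp
      have "q powi (int n + 1) = q powi int (d - i) * q powi (int (n + i) + 1 - int d)"
        using q i by (subst power_int_add[symmetric]) (auto simp: of_nat_diff)
      moreover have "int n + 2 - int (d - i) = int (n + i) + 2 - int d" using i by simp
      ultimately show "real (gen_fib d (int n + 2 - int (d - i))) * q powi (int n + 1) = p i * ?a (n + i)"
        by (simp only: p_def power_int_of_nat mult_ac)
    qed simp
    finally show ?thesis .
  qed
  obtain k where k: "d = Suc k" using d by (cases d) auto
  \<comment> \<open>Only the last position of the initial window is nonzero; its value is
    \<open>1\<close> and its weight is the full sum of the \<open>p j\<close>.\<close>
  have "(\<Sum>i<d. (\<Sum>j\<le>i. p j) * ?a i) = 1"
    using sum_p unfolding k by (subst sum.lessThan_Suc) (simp add: lessThan_Suc_atMost)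
  moreover have "(\<Sum>i<d. \<Sum>j\<le>i. p j) = (\<Sum>i=1..d. real i * q ^ i)"
  proof -
    \<comment> \<open>Exchanging the summations counts each \<open>p j\<close> once for every
      \<open>i\<close> from \<open>j\<close> to \<open>d - 1\<close>, hence \<open>d - j\<close>
      times.\<close>
    have "(\<Sum>i<d. \<Sum>j\<le>i. p j) = (\<Sum>j<d. \<Sum>i\<in>{j..<d}. p j)"
      unfolding sum.Sigma[OF finite_lessThan ballI[OF finite_atMost]]
      by (subst sum.Sigma) (auto intro!: sum.reindex_bij_witness[of _ prod.swap prod.swap])
    also have "\<dots> = (\<Sum>j<d. real (d - j) * q ^ (d - j))" by (simp add: p_def)
    also have "\<dots> = (\<Sum>i=1..d. real i * q ^ i)" by (rule sum_lessThan_reflect)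
    finally show ?thesis .
  qed
  ultimately show ?thesis
    using averaging_tendsto[of d p ?a] rec sum_p q d
    by (simp add: p_def gen_fib_const_def q_def)
qed

theorem theorem2p5:
  fixes d :: nat
  assumes "d \<ge> 2"
  shows "(\<exists>!x::real. 0 < x \<and> x < 1 \<and> (\<Sum>i=1..d. x ^ i) = 1) \<and>
    (let q = gen_fib_root d; c = gen_fib_const d in
      c = (q - 1)^2 / (real d * q ^ (d + 2) - real (d + 1) * q ^ (d + 1) + q) \<and>
      (\<lambda>n::int. real (gen_fib d n)) \<sim>[at_top] (\<lambda>n. c * q powi (- (n - 1))) \<and>
      ((\<lambda>n::int. real (gen_fib d n) / (c * q powi (- (n - 1)))) \<longlongrightarrow> 1) at_top)"
proof -
  define q where "q = gen_fib_root d"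
  define c where "c = gen_fib_const d"
  have q: "0 < q" "q < 1" using gen_fib_root[OF assms] by (auto simp: q_def)
  have "(\<Sum>i=1..d. real i * q ^ i) > 0"
    using q assms by (intro sum_pos) auto
  then have c: "c > 0" by (simp add: c_def gen_fib_const_def q_def)
  \<comment> \<open>The factor \<open>(q - 1)^2\<close> is nonzero because \<open>q < 1\<close>, so
    it cancels.\<close>
  have closed: "c = (q - 1)^2 / (real d * q ^ (d + 2) - real (d + 1) * q ^ (d + 1) + q)"
    using q unfolding sum_of_nat_mult_power[symmetric]
    by (simp add: c_def gen_fib_const_def q_def[symmetric])
  \<comment> \<open>This map undoes the index shift of
    \<open>gen_fib_scaled_tendsto\<close>.\<close>
  have "filterlim (\<lambda>n::int. nat (n - 2 + int d)) sequentially at_top"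
    unfolding filterlim_at_top
  proof
    fix k
    show "\<forall>\<^sub>F n::int in at_top. k \<le> nat (n - 2 + int d)"
      using eventually_ge_at_top[of "int k + 2"] by eventually_elim linarith
  qed
  from filterlim_compose[OF gen_fib_scaled_tendsto[OF assms] this]
  have "((\<lambda>n. real (gen_fib d (int (nat (n - 2 + int d)) + 2 - int d)) *
      q powi (int (nat (n - 2 + int d)) + 1 - int d) / c) \<longlongrightarrow> c / c) at_top"
    unfolding q_def[symmetric] c_def[symmetric] using c by (intro tendsto_divide) auto
  moreover have "\<forall>\<^sub>F n::int in at_top. real (gen_fib d (int (nat (n - 2 + int d)) + 2 - int d)) *
      q powi (int (nat (n - 2 + int d)) + 1 - int d) / c = real (gen_fib d n) / (c * q powi (- (n - 1)))"
    using eventually_ge_at_top[of 2]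
  proof eventually_elim
    case (elim n)
    \<comment> \<open>From \<open>n \<ge> 2\<close> on, the argument of \<open>nat\<close> is
      nonnegative, so nothing is truncated.\<close>
    then have "int (nat (n - 2 + int d)) = n - 2 + int d" by simp
    then show ?case
      by (simp only:) (simp add: power_int_minus[of q "n - 1", simplified] field_simps)
  qed
  ultimately have lim: "((\<lambda>n::int. real (gen_fib d n) / (c * q powi (- (n - 1)))) \<longlongrightarrow> 1) at_top"
    using c by (simp add: tendsto_cong)
  then have "(\<lambda>n::int. real (gen_fib d n)) \<sim>[at_top] (\<lambda>n. c * q powi (- (n - 1)))"
    by (rule asymp_equivI')
  then show ?thesis
    using ex1_sum_power_eq_1[OF assms] closed lim
    unfolding Let_def q_def[symmetric] c_def[symmetric] by blast
qed

end
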